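(* Let $n,h\in\mathbb{N}$. Every online algorithm for the $h$-RO-SP with $n$ online candidates has competitive-ratio at most $$\begin{cases}\frac{1}{e}\cdot\frac{n+h}{n}+\frac1n & \text{if } \frac{h}{n+h}\le\frac1e,\\ \frac{h}{n}\ln\left(\frac{h+n}{h}\right)+\frac1n & \text{otherwise};\end{cases}$$ that is, no algorithm is $c$-competitive for $c$ exceeding this quantity.
   Context: The random-order secretary problem with a sample of size $h$ ($h$-RO-SP), for integers $n\ge 1$, $h\ge 0$: an adversary picks a set $C$ of $n+h$ candidates with values in $\mathbb{R}_{\ge 0}$ (totally ordered by value, ties broken by a fixed consistent tie-breaker). A subset $H\subseteq C$ of cardinality $h$ (history set) is drawn uniformly at random and given to the online player upfront (together with $n$); the candidates of $O=C\setminus H$ are then presented one by one in a uniformly random order $c_1,\dots,c_n$; after each arrival the player must irrevocably accept or reject it, and accepting terminates. $\mathrm{ALG}$ is the value of the accepted candidate (0 if none), $\mathrm{OPT}=\max O$; an algorithm is $c$-competitive if $\mathbb{E}[\mathrm{ALG}]\ge c\,\mathbb{E}[\mathrm{OPT}]$ for every $C$, expectation over $H$, the random order, and the algorithm's randomness. *)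

theory Defs
  imports "HOL-Probability.Probability" "HOL-Combinatorics.Multiset_Permutations"
begin

text \<open>Candidates are ordered by value; among equal values the rank decides.\<close>

datatype candidate = Candidate (val: real) (rank: nat)

instantiation candidate :: linorder
begin

definition less_eq_candidate :: "candidate \<Rightarrow> candidate \<Rightarrow> bool" where
  "a \<le> b \<longleftrightarrow> val a < val b \<or> (val a = val b \<and> rank a \<le> rank b)"

definition less_candidate :: "candidate \<Rightarrow> candidate \<Rightarrow> bool" where
  "a < b \<longleftrightarrow> val a < val b \<or> (val a = val b \<and> rank a < rank b)"

instance
  by standard
    (auto simp: less_eq_candidate_def less_candidate_def intro: candidate.expand)

end

text \<open>
  A deterministic decision rule receives the history set \<open>H\<close> and the list of online
  candidates seen so far in order of arrival, the current one being the last, and says whether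
  the current candidate is accepted (assuming that all earlier ones were rejected).
  The number of online candidates is not an argument because it is fixed beforehand.
\<close>

type_synonym decision_rule = "candidate set \<Rightarrow> candidate list \<Rightarrow> bool"

definition alg_value :: "decision_rule \<Rightarrow> candidate set \<Rightarrow> candidate list \<Rightarrow> real" where
  "alg_value D H cs =
     (case find (\<lambda>i. D H (take (Suc i) cs)) [0..<length cs] of
        None \<Rightarrow> 0
      | Some i \<Rightarrow> val (cs ! i))"

text \<open>
  A randomized online algorithm: a decision rule that depends on an internal random outcome,
  drawn from an arbitrary probability space.
\<close>

definition online_algorithm :: "'r measure \<Rightarrow> ('r \<Rightarrow> decision_rule) \<Rightarrow> bool" where
  "online_algorithm M A \<longleftrightarrow>
     prob_space M \<and> (\<forall>H cs. {r \<in> space M. A r H cs} \<in> sets M)"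

definition history_and_arrivals ::
  "nat \<Rightarrow> candidate set \<Rightarrow> (candidate set \<times> candidate list) pmf" where
  "history_and_arrivals h C =
     bind_pmf (pmf_of_set {H. H \<subseteq> C \<and> card H = h})
       (\<lambda>H. map_pmf (\<lambda>cs. (H, cs)) (pmf_of_set (permutations_of_set (C - H))))"

text \<open>
  The internal randomness is independent of the history set and the arrival order, hence the
  iterated integral.
\<close>

definition expected_alg ::
  "'r measure \<Rightarrow> ('r \<Rightarrow> decision_rule) \<Rightarrow> nat \<Rightarrow> candidate set \<Rightarrow> real" where
  "expected_alg M A h C =
     measure_pmf.expectation (history_and_arrivals h C)
       (\<lambda>(H, cs). LINT r|M. alg_value (A r) H cs)"

definition expected_opt :: "nat \<Rightarrow> candidate set \<Rightarrow> real" where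
  "expected_opt h C =
     measure_pmf.expectation (history_and_arrivals h C) (\<lambda>(H, cs). val (Max (C - H)))"

definition competitive ::
  "nat \<Rightarrow> nat \<Rightarrow> 'r measure \<Rightarrow> ('r \<Rightarrow> decision_rule) \<Rightarrow> real \<Rightarrow> bool" where
  "competitive n h M A c \<longleftrightarrow>
     (\<forall>C. finite C \<and> card C = n + h \<and> (\<forall>x\<in>C. val x \<ge> 0) \<longrightarrow>
        expected_alg M A h C \<ge> c * expected_opt h C)"

end

theory Submission
  imports Defs "HOL-Library.Ramsey"
begin

text \<open>
  Let \<open>N = n + h\<close>. If the largest value dwarfs all others, then \<open>c * n / N\<close> is at most the
  probability of accepting the maximum. For a set \<open>S\<close> of \<open>h + i\<close> candidates consider the
  probability of stopping exactly at the \<open>i\<close>-th arrival, this being \<open>Max S\<close>, given that \<open>S\<close>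
  consists of the history and the first \<open>i\<close> arrivals. By Ramsey's theorem the adversary can restrict
  the candidates to an infinite set on which these probabilities are, up to \<open>\<epsilon>\<close>, numbers \<open>f i\<close>
  that do not depend on \<open>S\<close>. Conditioning on the last arrival being the maximum gives
  \<open>(h + i) * f i + (\<Sum>j<i. f j) \<le> 1\<close>, and the maximum of all candidates is accepted with probability
  about \<open>\<Sum>i. (h + i) / N * f i\<close>. The optimum of this linear program is bounded by a potential
  argument.
\<close>

subsection \<open>History sets and arrival orders\<close>

text \<open>One finite set of pairs turns expectations into plain averages and supports induction on
  the last arrival.\<close>

definition outcomes :: "nat \<Rightarrow> candidate set \<Rightarrow> (candidate set \<times> candidate list) set" where
  "outcomes h C = {(H, xs). H \<subseteq> C \<and> card H = h \<and> xs \<in> permutations_of_set (C - H)}"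

lemma outcomes_eq_Sigma:
  "outcomes h C = Sigma {H. H \<subseteq> C \<and> card H = h} (\<lambda>H. permutations_of_set (C - H))"
  by (auto simp: outcomes_def)

lemma outcomesD:
  assumes "finite C" "(H, xs) \<in> outcomes h C"
  shows "H \<subseteq> C" "card H = h" "set xs = C - H" "distinct xs" "length xs = card C - h"
proof -
  show *: "H \<subseteq> C" "card H = h" "set xs = C - H" "distinct xs"
    using assms by (auto simp: outcomes_def permutations_of_set_def)
  have "length xs = card (C - H)"
    using * by (metis distinct_card)
  then show "length xs = card C - h"
    using * assms(1) by (simp add: card_Diff_subset finite_subset)
qed

lemma finite_outcomes: "finite C \<Longrightarrow> finite (outcomes h C)"
  unfolding outcomes_eq_Sigma by (intro finite_SigmaI) auto

lemma card_outcomes: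
  assumes "finite C"
  shows "card (outcomes h C) = (card C choose h) * fact (card C - h)"
proof -
  have "card (outcomes h C) = (\<Sum>H | H \<subseteq> C \<and> card H = h. card (permutations_of_set (C - H)))"
    unfolding outcomes_eq_Sigma using assms by (intro card_SigmaI) auto
  also have "\<dots> = (\<Sum>H | H \<subseteq> C \<and> card H = h. fact (card C - h))"
    using assms by (intro sum.cong refl) (auto simp: card_Diff_subset finite_subset)
  finally show ?thesis
    using assms by (simp add: n_subsets)
qed

lemma outcomes_nonempty:
  assumes "finite C" "h \<le> card C"
  shows "outcomes h C \<noteq> {}"
proof -
  have "card (outcomes h C) > 0"
    using assms by (simp add: card_outcomes)
  then show ?thesis by auto
qed

text \<open>Every history set leaves the same number \<open>fact (card C - h)\<close> of arrival
  orders, so the two-stage draw is uniform on pairs.\<close>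

lemma history_and_arrivals_eq:
  assumes "finite C" "h \<le> card C"
  shows "history_and_arrivals h C = pmf_of_set (outcomes h C)"
proof -
  let ?A = "{H. H \<subseteq> C \<and> card H = h}" and ?f = "\<lambda>H. Pair H ` permutations_of_set (C - H)"
  have eq: "outcomes h C = \<Union> (?f ` ?A)"
    by (auto simp: outcomes_def)
  have "?A \<noteq> {}"
    using outcomes_nonempty[OF assms] by (auto simp: outcomes_def)
  moreover have "card (?f H) = fact (card C - h)" if "H \<in> ?A" for H
    using that assms
    by (subst card_image) (auto simp: inj_on_def card_Diff_subset finite_subset)
  moreover have "?f H \<noteq> {}" for H
    using assms by (simp add: permutations_of_set_empty_iff)
  moreover have "disjoint_family_on ?f ?A"
    by (auto simp: disjoint_family_on_def)
  ultimately have "pmf_of_set (outcomes h C) = pmf_of_set ?A \<bind> (\<lambda>H. pmf_of_set (?f H))"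
    unfolding eq using finite_outcomes[OF assms(1), of h]
    by (intro pmf_of_set_UN) (auto simp: eq)
  also have "\<dots> = history_and_arrivals h C"
    unfolding history_and_arrivals_def using assms
    by (intro bind_pmf_cong refl map_pmf_of_set_inj[symmetric])
       (auto simp: inj_on_def permutations_of_set_empty_iff)
  finally show ?thesis ..
qed

text \<open>Splitting off the last arrival is the recursion behind the inductions on
  \<open>card S\<close>; \<open>h < card C\<close> ensures that somebody arrives.\<close>

lemma outcomes_last:
  assumes "finite C" "h < card C"
  shows "outcomes h C = (\<Union>x\<in>C. (\<lambda>(H, ys). (H, ys @ [x])) ` outcomes h (C - {x}))" (is "?L = ?R")
proof (intro equalityI subsetI)
  fix p assume p: "p \<in> ?L"
  obtain H xs where [simp]: "p = (H, xs)" by (cases p)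
  note D = outcomesD[OF assms(1) p[simplified]]
  have "xs \<noteq> []" using D assms by auto
  then obtain ys x where xs: "xs = ys @ [x]" by (metis rev_exhaust)
  have "(H, ys) \<in> outcomes h (C - {x})"
    using D xs by (auto simp: outcomes_def permutations_of_set_def)
  moreover have "x \<in> C" using D xs by auto
  ultimately show "p \<in> ?R" by (force simp: xs)
next
  fix p assume "p \<in> ?R"
  then obtain x H ys where x: "x \<in> C" "(H, ys) \<in> outcomes h (C - {x})" "p = (H, ys @ [x])"
    by auto
  have "finite (C - {x})" using assms by simp
  note D = outcomesD[OF this x(2)]
  show "p \<in> ?L"
    using D x by (auto simp: outcomes_def permutations_of_set_def)
qed

section \<open>Averages over outcomes\<close>

definition mean ::
  "nat \<Rightarrow> candidate set \<Rightarrow> (candidate set \<Rightarrow> candidate list \<Rightarrow> real) \<Rightarrow> real" where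
  "mean h C g = measure_pmf.expectation (history_and_arrivals h C) (\<lambda>(H, xs). g H xs)"

lemma mean_eq_sum:
  assumes "finite C" "h \<le> card C"
  shows "mean h C g = (\<Sum>(H, xs)\<in>outcomes h C. g H xs) / card (outcomes h C)"
  unfolding mean_def history_and_arrivals_eq[OF assms]
  by (intro integral_pmf_of_set outcomes_nonempty finite_outcomes assms)

lemma mean_mono:
  assumes "finite C" "h \<le> card C"
    and "\<And>H xs. (H, xs) \<in> outcomes h C \<Longrightarrow> g H xs \<le> g' H xs"
  shows "mean h C g \<le> mean h C g'"
  unfolding mean_eq_sum[OF assms(1,2)] using assms(3)
  by (intro divide_right_mono sum_mono) auto

lemma mean_cong:
  assumes "finite C" "h \<le> card C"
    and "\<And>H xs. (H, xs) \<in> outcomes h C \<Longrightarrow> g H xs = g' H xs"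
  shows "mean h C g = mean h C g'"
  using assms by (intro antisym mean_mono) auto

lemma mean_const: "mean h C (\<lambda>_ _. a) = a"
  unfolding mean_def by (simp add: split_def)

lemma mean_add:
  assumes "finite C" "h \<le> card C"
  shows "mean h C (\<lambda>H xs. g H xs + g' H xs) = mean h C g + mean h C g'"
  unfolding mean_eq_sum[OF assms] by (simp add: split_def sum.distrib add_divide_distrib)

lemma mean_cmult:
  assumes "finite C" "h \<le> card C"
  shows "mean h C (\<lambda>H xs. a * g H xs) = a * mean h C g"
  unfolding mean_eq_sum[OF assms] by (simp add: split_def sum_distrib_left)

lemma mean_sum:
  assumes "finite C" "h \<le> card C"
  shows "mean h C (\<lambda>H xs. \<Sum>i\<in>I. g i H xs) = (\<Sum>i\<in>I. mean h C (g i))"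
  unfolding mean_eq_sum[OF assms] split_def by (subst sum.swap) (simp add: sum_divide_distrib)

text \<open>The last arrival is uniform in \<open>C\<close>.\<close>

lemma mean_last:
  assumes "finite C" "h < card C"
  shows "mean h C g = (\<Sum>x\<in>C. mean h (C - {x}) (\<lambda>H ys. g H (ys @ [x]))) / card C"
proof -
  let ?app = "\<lambda>x (H, ys). (H, ys @ [x])"
  let ?S = "\<lambda>x. outcomes h (C - {x})"
  have fin: "finite (C - {x})" for x using assms by simp
  have cd: "card (C - {x}) = card C - 1" "h \<le> card (C - {x})" if "x \<in> C" for x
    using that assms by auto
  have inj: "inj_on (?app x) (?S x)" for x
    by (auto simp: inj_on_def)
  \<comment> \<open>The number of outcomes with a prescribed last arrival. It is the same for every
    \<open>x\<close>, so the average over outcomes is an average of averages.\<close>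
  define k where "k = ((card C - 1) choose h) * fact (card C - 1 - h)"
  have ck: "card (?S x) = k" if "x \<in> C" for x
    using cd[OF that] by (simp add: card_outcomes[OF fin] k_def)
  have disj: "\<forall>x\<in>C. \<forall>y\<in>C. x \<noteq> y \<longrightarrow> ?app x ` ?S x \<inter> ?app y ` ?S y = {}"
    by auto
  have finS: "\<forall>x\<in>C. finite (?app x ` ?S x)"
    using fin by (auto intro: finite_outcomes)
  have "card (outcomes h C) = (\<Sum>x\<in>C. card (?app x ` ?S x))"
    unfolding outcomes_last[OF assms] by (rule card_UN_disjoint[OF assms(1) finS disj])
  also have "\<dots> = card C * k"
    using inj ck by (simp add: card_image)
  finally have card: "card (outcomes h C) = card C * k" .
  have "(\<Sum>p\<in>outcomes h C. case p of (H, xs) \<Rightarrow> g H xs)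
      = (\<Sum>x\<in>C. \<Sum>p\<in>?app x ` ?S x. case p of (H, xs) \<Rightarrow> g H xs)"
    unfolding outcomes_last[OF assms] by (rule sum.UNION_disjoint[OF assms(1) finS disj])
  also have "\<dots> = (\<Sum>x\<in>C. \<Sum>(H, ys)\<in>?S x. g H (ys @ [x]))"
  proof (rule sum.cong[OF refl])
    fix x assume "x \<in> C"
    show "(\<Sum>p\<in>?app x ` ?S x. case p of (H, xs) \<Rightarrow> g H xs) = (\<Sum>(H, ys)\<in>?S x. g H (ys @ [x]))"
      by (subst sum.reindex[OF inj]) (simp add: split_def o_def)
  qed
  also have "\<dots> = (\<Sum>x\<in>C. k * mean h (C - {x}) (\<lambda>H ys. g H (ys @ [x])))"
  proof (intro sum.cong refl)
    fix x assume x: "x \<in> C"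
    have "k > 0"
      using assms by (auto simp: k_def)
    then show "(\<Sum>(H, ys)\<in>?S x. g H (ys @ [x])) = k * mean h (C - {x}) (\<lambda>H ys. g H (ys @ [x]))"
      using mean_eq_sum[OF fin cd(2)[OF x], of "\<lambda>H ys. g H (ys @ [x])"] ck[OF x] by simp
  qed
  also have "\<dots> = k * (\<Sum>x\<in>C. mean h (C - {x}) (\<lambda>H ys. g H (ys @ [x])))"
    by (simp add: sum_distrib_left)
  finally have s: "(\<Sum>p\<in>outcomes h C. case p of (H, xs) \<Rightarrow> g H xs) = \<dots>" .
  have "k > 0" using assms by (auto simp: k_def)
  then show ?thesis
    using mean_eq_sum[OF assms(1) less_imp_le[OF assms(2)], of g]
    by (simp add: s card)
qed

subsection \<open>Stopping probabilities\<close>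

text \<open>Here \<open>xs\<close> ends with the accepted candidate. The case \<open>k = 0\<close>
  is excluded because a rule is never consulted before the first arrival.\<close>

definition stops_at :: "decision_rule \<Rightarrow> candidate set \<Rightarrow> candidate list \<Rightarrow> bool" where
  "stops_at D H xs \<longleftrightarrow> D H xs \<and> (\<forall>k. 0 < k \<and> k < length xs \<longrightarrow> \<not> D H (take k xs))"

definition stop_prob ::
  "'r measure \<Rightarrow> ('r \<Rightarrow> decision_rule) \<Rightarrow> candidate set \<Rightarrow> candidate list \<Rightarrow> real" where
  "stop_prob M A H xs = measure M {r \<in> space M. stops_at (A r) H xs}"

lemma stops_at_unique:
  assumes "stops_at D H (take (Suc i) xs)" "stops_at D H (take (Suc j) xs)"
    and "i < length xs" "j < length xs"
  shows "i = j"
proof (rule ccontr)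
  assume "i \<noteq> j"
  moreover have False
    if "i < j" "stops_at D H (take (Suc i) xs)" "stops_at D H (take (Suc j) xs)" "j < length xs"
    for i j
  proof -
    have "\<not> D H (take (Suc i) (take (Suc j) xs))"
      using that(1,3,4) by (simp add: stops_at_def)
    moreover have "take (Suc i) (take (Suc j) xs) = take (Suc i) xs"
      using that(1) by (simp add: take_take min_def)
    ultimately show False
      using that(2) by (simp add: stops_at_def)
  qed
  ultimately show False
    using assms by (metis linorder_neqE_nat)
qed

text \<open>At most one stopping event occurs, so the sequential search becomes linear in the
  indicators of these events. If nothing is accepted, all summands vanish, in agreement with the
  default value 0.\<close>

lemma alg_value_eq_sum:
  "alg_value D H xs =
     (\<Sum>i<length xs. val (xs ! i) * of_bool (stops_at D H (take (Suc i) xs)))"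
proof (cases "find (\<lambda>i. D H (take (Suc i) xs)) [0..<length xs]")
  case None
  then have "\<not> D H (take (Suc i) xs)" if "i < length xs" for i
    using that by (auto simp: find_None_iff)
  then show ?thesis
    using None by (simp add: alg_value_def stops_at_def)
next
  case (Some i)
  then have i: "i < length xs" "D H (take (Suc i) xs)" "\<forall>j<i. \<not> D H (take (Suc j) xs)"
    by (auto simp: find_Some_iff)
  have st: "stops_at D H (take (Suc i) xs)"
    unfolding stops_at_def
  proof (intro conjI allI impI)
    show "D H (take (Suc i) xs)" by (fact i(2))
  next
    fix k assume "0 < k \<and> k < length (take (Suc i) xs)"
    then obtain j where j: "k = Suc j" "j < i" by (cases k) auto
    then have "take k (take (Suc i) xs) = take (Suc j) xs"
      by (simp add: take_take min_def)
    then show "\<not> D H (take k (take (Suc i) xs))"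
      using i(3) j(2) by simp
  qed
  have "(\<Sum>j<length xs. val (xs ! j) * of_bool (stops_at D H (take (Suc j) xs)))
      = (\<Sum>j<length xs. if j = i then val (xs ! i) else 0)"
  proof (intro sum.cong refl)
    fix j assume "j \<in> {..<length xs}"
    then have "stops_at D H (take (Suc j) xs) \<longleftrightarrow> j = i"
      using st stops_at_unique[OF st _ i(1), of j] by blast
    then show "val (xs ! j) * of_bool (stops_at D H (take (Suc j) xs))
        = (if j = i then val (xs ! i) else 0)"
      by simp
  qed
  also have "\<dots> = val (xs ! i)"
    using i(1) by simp
  finally show ?thesis
    using Some by (simp add: alg_value_def)
qed

section \<open>Expectation over the internal randomness\<close>

context
  fixes M :: "'r measure" and A :: "'r \<Rightarrow> decision_rule"
  assumes online: "online_algorithm M A"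
begin

interpretation prob_space M
  using online by (simp add: online_algorithm_def)

lemma stops_at_measurable: "{r \<in> space M. stops_at (A r) H xs} \<in> sets M"
proof -
  have [measurable]: "Measurable.pred M (\<lambda>r. A r H ys)" for ys
    using online by (simp add: online_algorithm_def pred_def)
  show ?thesis
    unfolding stops_at_def by measurable
qed

text \<open>The events of stopping at different positions of one list are disjoint.\<close>

lemma sum_stop_prob_le_1: "(\<Sum>i<length xs. stop_prob M A H (take (Suc i) xs)) \<le> 1"
proof -
  let ?E = "\<lambda>i. {r \<in> space M. stops_at (A r) H (take (Suc i) xs)}"
  have "(\<Sum>i<length xs. stop_prob M A H (take (Suc i) xs)) = prob (\<Union>i<length xs. ?E i)"
    unfolding stop_prob_def using stops_at_measurable
    by (intro finite_measure_finite_Union[symmetric])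
       (auto simp: disjoint_family_on_def dest: stops_at_unique)
  then show ?thesis by simp
qed

lemma expected_alg_value:
  "(LINT r|M. alg_value (A r) H xs) =
     (\<Sum>i<length xs. val (xs ! i) * stop_prob M A H (take (Suc i) xs))"
proof -
  have eq: "(LINT r|M. of_bool (stops_at (A r) H ys)) = stop_prob M A H ys"
    and int: "integrable M (\<lambda>r. of_bool (stops_at (A r) H ys) :: real)" for ys
  proof -
    have ind: "of_bool (stops_at (A r) H ys) = (indicator {r \<in> space M. stops_at (A r) H ys} r :: real)"
      if "r \<in> space M" for r
      using that by (simp add: indicator_def)
    have "(LINT r|M. of_bool (stops_at (A r) H ys)) =
        (LINT r|M. indicator {r \<in> space M. stops_at (A r) H ys} r :: real)"
      by (intro Bochner_Integration.integral_cong refl ind)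
    then show "(LINT r|M. of_bool (stops_at (A r) H ys)) = stop_prob M A H ys"
      using stops_at_measurable by (simp add: stop_prob_def)
    have "integrable M (indicator {r \<in> space M. stops_at (A r) H ys} :: 'r \<Rightarrow> real)"
      using stops_at_measurable[of H ys]
      by (intro integrable_real_indicator) (auto simp: emeasure_eq_measure)
    then show "integrable M (\<lambda>r. of_bool (stops_at (A r) H ys) :: real)"
      by (rule Bochner_Integration.integrable_cong[THEN iffD1, OF refl, rotated]) (simp add: ind)
  qed
  show ?thesis
    unfolding alg_value_eq_sum using int eq by (subst Bochner_Integration.integral_sum) simp_all
qed

end

subsection \<open>Restricting the candidates to a homogeneous set\<close>

text \<open>Induction on \<open>n\<close>: Ramsey's theorem for \<open>r n\<close>-subsets is
  applied inside the set already found, and the earlier estimates survive the passage to a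
  subset.\<close>

lemma homogeneous_approx:
  fixes F :: "nat \<Rightarrow> 'a set \<Rightarrow> real" and r :: "nat \<Rightarrow> nat"
  assumes "infinite Z" "\<epsilon> > 0"
    and F: "\<And>i S. i < n \<Longrightarrow> finite S \<Longrightarrow> card S = r i \<Longrightarrow> 0 \<le> F i S \<and> F i S \<le> 1"
  shows "\<exists>Y f. Y \<subseteq> Z \<and> infinite Y \<and>
    (\<forall>i<n. 0 \<le> f i \<and> (\<forall>S. S \<subseteq> Y \<and> finite S \<and> card S = r i \<longrightarrow> f i \<le> F i S \<and> F i S \<le> f i + \<epsilon>))"
  using F
proof (induction n)
  case 0
  then show ?case using assms(1) by auto
next
  case (Suc n)
  from Suc.IH Suc.prems obtain Y f where Y: "Y \<subseteq> Z" "infinite Y"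
    and f: "\<And>i. i < n \<Longrightarrow> 0 \<le> f i"
      "\<And>i S. i < n \<Longrightarrow> S \<subseteq> Y \<Longrightarrow> finite S \<Longrightarrow> card S = r i \<Longrightarrow> f i \<le> F i S \<and> F i S \<le> f i + \<epsilon>"
    by (metis less_SucI)
  \<comment> \<open>The colour is the index of the cell of width \<open>\<epsilon>\<close> that
    contains the value; values in the unit interval need finitely many colours.\<close>
  define col where "col S = nat \<lfloor>F n S / \<epsilon>\<rfloor>" for S
  have "col S < Suc (nat \<lfloor>1 / \<epsilon>\<rfloor>)" if "finite S" "card S = r n" for S
  proof -
    have "F n S / \<epsilon> \<le> 1 / \<epsilon>"
      using Suc.prems[of n S] that assms(2) by (intro divide_right_mono) auto
    then have "col S \<le> nat \<lfloor>1 / \<epsilon>\<rfloor>"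
      unfolding col_def by (intro nat_mono floor_mono)
    then show ?thesis by simp
  qed
  then obtain Y' t where Y': "Y' \<subseteq> Y" "infinite Y'"
    and t: "\<And>S. S \<subseteq> Y' \<Longrightarrow> finite S \<Longrightarrow> card S = r n \<Longrightarrow> col S = t"
    using Ramsey[OF Y(2), of "r n" col "Suc (nat \<lfloor>1 / \<epsilon>\<rfloor>)"] by metis
  \<comment> \<open>The new value is the left end of the common cell, hence a lower bound that is
    off by at most \<open>\<epsilon>\<close>.\<close>
  define f' where "f' = f(n := \<epsilon> * t)"
  have new: "\<epsilon> * t \<le> F n S \<and> F n S \<le> \<epsilon> * t + \<epsilon>" if "S \<subseteq> Y'" "finite S" "card S = r n" for S
  proof -
    have "0 \<le> F n S / \<epsilon>"
      using Suc.prems[of n S] that assms(2) by simp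
    then have "0 \<le> \<lfloor>F n S / \<epsilon>\<rfloor>"
      by (simp only: zero_le_floor)
    then have "int t = \<lfloor>F n S / \<epsilon>\<rfloor>"
      using t[OF that] by (auto simp: col_def)
    then have "t \<le> F n S / \<epsilon>" "F n S / \<epsilon> \<le> t + 1"
      by linarith+
    then show ?thesis
      using assms(2) by (simp add: field_simps)
  qed
  have "0 \<le> f' i \<and> (\<forall>S. S \<subseteq> Y' \<and> finite S \<and> card S = r i \<longrightarrow> f' i \<le> F i S \<and> F i S \<le> f' i + \<epsilon>)"
    if "i < Suc n" for i
  proof (cases "i = n")
    case True
    then show ?thesis using new assms(2) by (simp add: f'_def)
  next
    case False
    then show ?thesis using f[of i] that Y'(1) by (auto simp: f'_def)
  qed
  then show ?case
    using Y Y' by (intro exI[of _ Y'] exI[of _ f']) auto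
qed

text \<open>Deleting late arrivals leaves a random subset \<open>T\<close> of size
  \<open>h + k\<close> with a random outcome on it, so the left side bounds an average of the values
  \<open>mean h T g\<close>.\<close>

lemma mean_prefix_ge:
  assumes "finite S" "h + k \<le> card S"
    and "\<And>T. T \<subseteq> S \<Longrightarrow> card T = h + k \<Longrightarrow> a \<le> mean h T g"
  shows "a \<le> mean h S (\<lambda>H xs. g H (take k xs))"
  using assms
proof (induction "card S" arbitrary: S rule: less_induct)
  case less
  note fin = less.prems(1)
  show ?case
  proof (cases "card S = h + k")
    case True
    have "mean h S (\<lambda>H xs. g H (take k xs)) = mean h S g"
      using True outcomesD(5)[OF fin] by (intro mean_cong fin) auto
    then show ?thesis using less.prems(3)[of S] True by simp
  next
    case False
    with less.prems have lt: "h + k < card S" by simp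
    have "a \<le> mean h (S - {x}) (\<lambda>H ys. g H (take k (ys @ [x])))" if "x \<in> S" for x
    proof -
      have c: "card (S - {x}) = card S - 1" using that fin by simp
      have "a \<le> mean h (S - {x}) (\<lambda>H ys. g H (take k ys))"
        using that fin lt c less.prems(3) by (intro less.hyps) auto
      \<comment> \<open>At least \<open>k\<close> candidates precede \<open>x\<close>, so truncation
        to \<open>k\<close> arrivals does not see it.\<close>
      also have "\<dots> = mean h (S - {x}) (\<lambda>H ys. g H (take k (ys @ [x])))"
        using lt c fin outcomesD(5)[of "S - {x}" _ _ h] by (intro mean_cong) auto
      finally show ?thesis .
    qed
    then have "(\<Sum>x\<in>S. a) \<le> (\<Sum>x\<in>S. mean h (S - {x}) (\<lambda>H ys. g H (take k (ys @ [x]))))"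
      by (rule sum_mono)
    then show ?thesis
      using lt mean_last[OF fin, of h "\<lambda>H xs. g H (take k xs)"]
      by (simp add: le_divide_eq mult.commute del: take_append)
  qed
qed

text \<open>The overall maximum lies among the history and the first \<open>i + 1\<close> arrivals
  with probability \<open>(h + Suc i) / card S\<close>. In that case it is the maximum of that
  subset, where the bound \<open>b\<close> applies.\<close>

lemma mean_prefix_Max_le:
  assumes "finite S" "h + Suc i \<le> card S"
    and "\<And>T. T \<subseteq> S \<Longrightarrow> card T = h + Suc i \<Longrightarrow> mean h T (\<lambda>H xs. g H xs * of_bool (last xs = Max T)) \<le> b"
  shows "mean h S (\<lambda>H xs. g H (take (Suc i) xs) * of_bool (xs ! i = Max S))
    \<le> real (h + Suc i) / real (card S) * b"
  using assms
proof (induction "card S" arbitrary: S rule: less_induct)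
  case less
  note fin = less.prems(1)
  let ?g = "\<lambda>S H xs. g H (take (Suc i) xs) * of_bool (xs ! i = Max S)"
  show ?case
  proof (cases "card S = h + Suc i")
    case True
    have "mean h S (?g S) = mean h S (\<lambda>H xs. g H xs * of_bool (last xs = Max S))"
    proof (intro mean_cong fin)
      fix H xs assume "(H, xs) \<in> outcomes h S"
      then have "length xs = Suc i"
        using True outcomesD(5)[OF fin] by auto
      then show "?g S H xs = g H xs * of_bool (last xs = Max S)"
        by (subst last_conv_nth) auto
    qed (use True in simp)
    then show ?thesis using less.prems(3)[of S] True by simp
  next
    case False
    with less.prems have lt: "h + Suc i < card S" by simp
    then have ne: "S \<noteq> {}" by auto
    \<comment> \<open>The bound given by the induction hypothesis after one candidate has been
      removed.\<close>
    define c where "c = real (h + Suc i) / real (card S - 1) * b"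
    have step: "mean h (S - {x}) (\<lambda>H ys. ?g S H (ys @ [x])) \<le> (if x = Max S then 0 else c)"
      if "x \<in> S" for x
    proof -
      have cd: "card (S - {x}) = card S - 1" using that fin by simp
      have fin': "finite (S - {x})" and le: "h \<le> card (S - {x})" using fin lt cd by auto
      have eq: "mean h (S - {x}) (\<lambda>H ys. ?g S H (ys @ [x])) = mean h (S - {x}) (?g S)"
      proof (intro mean_cong fin' le)
        fix H ys assume "(H, ys) \<in> outcomes h (S - {x})"
        then have "length ys > i"
          using outcomesD(5)[OF fin'] cd lt by auto
        then show "?g S H (ys @ [x]) = ?g S H ys"
          by (simp add: nth_append)
      qed
      show ?thesis
      proof (cases "x = Max S")
        case True
        \<comment> \<open>If the maximum arrives last, it cannot be the earlier arrival at index
          \<open>i\<close>.\<close>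
        have "mean h (S - {x}) (?g S) = mean h (S - {x}) (\<lambda>_ _. 0)"
        proof (intro mean_cong fin' le)
          fix H ys assume o: "(H, ys) \<in> outcomes h (S - {x})"
          then have "length ys > i"
            using outcomesD(5)[OF fin'] cd lt by auto
          then have "ys ! i \<in> S - {x}"
            using outcomesD(3)[OF fin' o] by (metis DiffE nth_mem)
          then show "?g S H ys = 0"
            using True by auto
        qed
        then show ?thesis
          using True eq mean_const[of _ _ 0] by (simp del: take_append)
      next
        case False
        then have "Max (S - {x}) = Max S"
          using fin ne by (intro Max_eqI) auto
        moreover have "mean h (S - {x}) (?g (S - {x})) \<le> c"
          unfolding c_def cd[symmetric]
          using that fin lt cd less.prems(3) by (intro less.hyps) auto
        ultimately show ?thesis
          using False eq by simp
      qed
    qed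
    have "(\<Sum>x\<in>S. mean h (S - {x}) (\<lambda>H ys. ?g S H (ys @ [x])))
        \<le> (\<Sum>x\<in>S. if x = Max S then 0 else c)"
      by (intro sum_mono step)
    also have "\<dots> = (\<Sum>x\<in>S - {Max S}. c)"
      using fin by (intro sum.mono_neutral_cong_right) auto
    \<comment> \<open>The \<open>card S - 1\<close> removals other than the maximum cancel the
      denominator of \<open>c\<close>.\<close>
    also have "\<dots> = real (h + Suc i) * b"
      using lt fin ne by (simp add: c_def)
    finally show ?thesis
      using lt mean_last[OF fin, of h "?g S"]
      by (simp add: divide_right_mono del: take_append)
  qed
qed

text \<open>A fixed candidate escapes a uniform history set with this probability. In the induction
  it is either the last arrival, hence online, or still present after the removal.\<close>

lemma mean_online:
  assumes "finite S" "h \<le> card S" "m \<in> S"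
  shows "mean h S (\<lambda>H xs. of_bool (m \<in> set xs)) = (real (card S) - real h) / real (card S)"
  using assms
proof (induction "card S" arbitrary: S rule: less_induct)
  case less
  note fin = less.prems(1)
  have pos: "card S > 0" using less.prems by (auto simp: card_gt_0_iff)
  show ?case
  proof (cases "card S = h")
    case True
    have "mean h S (\<lambda>H xs. of_bool (m \<in> set xs)) = mean h S (\<lambda>_ _. 0 :: real)"
      using outcomesD(5)[OF fin] True by (intro mean_cong fin) fastforce+
    then show ?thesis
      using True by (simp add: mean_const)
  next
    case False
    with less.prems have lt: "h < card S" by simp
    have "mean h (S - {x}) (\<lambda>H ys. of_bool (m \<in> set (ys @ [x]))) =
        (if x = m then 1 else (real (card S) - 1 - real h) / (real (card S) - 1))" if "x \<in> S" for x
    proof -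
      have cd: "card (S - {x}) = card S - 1" using that fin by simp
      have fin': "finite (S - {x})" and le: "h \<le> card (S - {x})" using fin lt cd by auto
      show ?thesis
      proof (cases "x = m")
        case True
        then show ?thesis using mean_const[of _ _ 1] by simp
      next
        case False
        have "mean h (S - {x}) (\<lambda>H ys. of_bool (m \<in> set ys)) =
            (real (card (S - {x})) - real h) / real (card (S - {x}))"
          using less.prems False cd lt by (intro less.hyps) auto
        then show ?thesis
          using False lt by (simp add: cd of_nat_diff)
      qed
    qed
    then have "(\<Sum>x\<in>S. mean h (S - {x}) (\<lambda>H ys. of_bool (m \<in> set (ys @ [x])))) =
        1 + (\<Sum>x\<in>S - {m}. (real (card S) - 1 - real h) / (real (card S) - 1))"
      using less.prems by (simp add: sum.remove[of S m])
    also have "(\<Sum>x\<in>S - {m}. (real (card S) - 1 - real h) / (real (card S) - 1)) = 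
        real (card S) - 1 - real h"
    \<comment> \<open>For a single candidate the denominator is 0, but then the sum is empty and
      \<open>h = 0\<close>.\<close>
    proof (cases "card S = 1")
      case True
      then show ?thesis using lt less.prems by (auto simp: card_1_singleton_iff)
    next
      case False
      then show ?thesis using pos less.prems by (simp add: of_nat_diff)
    qed
    finally show ?thesis
      using mean_last[OF fin lt, of "\<lambda>H xs. of_bool (m \<in> set xs)"] by simp
  qed
qed

text \<open>The winning probability at the last arrival when \<open>S\<close> is all that has been
  seen. It depends on \<open>S\<close> alone, so it can serve as the set function for Ramsey's
  theorem.\<close>

definition record_stop_prob ::
  "'r measure \<Rightarrow> ('r \<Rightarrow> decision_rule) \<Rightarrow> nat \<Rightarrow> candidate set \<Rightarrow> real" where
  "record_stop_prob M A h S = mean h S (\<lambda>H xs. stop_prob M A H xs * of_bool (last xs = Max S))"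

lemma record_stop_prob_nonneg:
  assumes "finite S" "h \<le> card S"
  shows "0 \<le> record_stop_prob M A h S"
proof -
  have "mean h S (\<lambda>_ _. 0) \<le> record_stop_prob M A h S"
    unfolding record_stop_prob_def using assms
    by (intro mean_mono) (auto simp: stop_prob_def)
  then show ?thesis by (simp add: mean_const assms)
qed

text \<open>
  Given that the last of the first \<open>h + i + 1\<close> candidates is their maximum, the previous ones
  arrive as in the problem on the remaining set.
\<close>

lemma record_stop_prob_constraint:
  assumes "online_algorithm M A" "finite S" "card S = h + Suc i"
    and f: "\<And>j T. j < i \<Longrightarrow> T \<subseteq> S \<Longrightarrow> card T = h + Suc j \<Longrightarrow> f j \<le> record_stop_prob M A h T"
  shows "real (h + Suc i) * record_stop_prob M A h S + (\<Sum>j<i. f j) \<le> 1"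
proof -
  define m where "m = Max S"
  have m: "m \<in> S" unfolding m_def using assms by (intro Max_in) auto
  define S' where "S' = S - {m}"
  have S': "finite S'" "card S' = h + i" "h \<le> card S'"
    using assms m by (auto simp: S'_def)
  let ?p = "stop_prob M A"
  have "record_stop_prob M A h S =
      (\<Sum>x\<in>S. mean h (S - {x}) (\<lambda>H ys. ?p H (ys @ [x]) * of_bool (x = m))) / card S"
    unfolding record_stop_prob_def using assms by (subst mean_last) (auto simp: m_def)
  also have "(\<Sum>x\<in>S. mean h (S - {x}) (\<lambda>H ys. ?p H (ys @ [x]) * of_bool (x = m)))
      = mean h S' (\<lambda>H ys. ?p H (ys @ [m]))
        + (\<Sum>x\<in>S - {m}. mean h (S - {x}) (\<lambda>H ys. ?p H (ys @ [x]) * of_bool (x = m)))"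
    using m assms(2) by (simp add: sum.remove[of S m] S'_def)
  also have "(\<Sum>x\<in>S - {m}. mean h (S - {x}) (\<lambda>H ys. ?p H (ys @ [x]) * of_bool (x = m))) = 0"
    using assms by (intro sum.neutral) (auto simp: mean_const)
  \<comment> \<open>The last arrival is the maximum with probability \<open>1 / card S\<close>;
    multiplying by \<open>card S\<close> conditions on this event.\<close>
  finally have rec: "real (h + Suc i) * record_stop_prob M A h S = mean h S' (\<lambda>H ys. ?p H (ys @ [m]))"
    using assms(3) by simp
  \<comment> \<open>Stopping at a record is one way of stopping, so \<open>f j\<close> also bounds
    the probability of any stop at this position from below.\<close>
  have "f j \<le> mean h S' (\<lambda>H ys. ?p H (take (Suc j) ys))" if "j < i" for j
  proof (rule mean_prefix_ge)
    fix T assume T: "T \<subseteq> S'" "card T = h + Suc j"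
    then have "f j \<le> record_stop_prob M A h T"
      using that by (intro f) (auto simp: S'_def)
    also have "\<dots> \<le> mean h T ?p"
      unfolding record_stop_prob_def using T S'
      by (intro mean_mono) (auto simp: stop_prob_def finite_subset)
    finally show "f j \<le> mean h T ?p" .
  qed (use S' that in auto)
  then have "(\<Sum>j<i. f j) \<le> (\<Sum>j<i. mean h S' (\<lambda>H ys. ?p H (take (Suc j) ys)))"
    by (intro sum_mono) auto
  then have "real (h + Suc i) * record_stop_prob M A h S + (\<Sum>j<i. f j)
      \<le> mean h S' (\<lambda>H ys. ?p H (ys @ [m]) + (\<Sum>j<i. ?p H (take (Suc j) ys)))"
    unfolding rec by (simp add: mean_add mean_sum S')
  also have "\<dots> \<le> mean h S' (\<lambda>_ _. 1)"
  proof (intro mean_mono S')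
    fix H ys assume "(H, ys) \<in> outcomes h S'"
    then have len: "length ys = i"
      using outcomesD(5)[OF S'(1)] S'(2) by auto
    \<comment> \<open>The summands are the probabilities of disjoint stops along the single list
      \<open>ys @ [m]\<close>.\<close>
    then show "?p H (ys @ [m]) + (\<Sum>j<i. ?p H (take (Suc j) ys)) \<le> 1"
      using sum_stop_prob_le_1[OF assms(1), of H "ys @ [m]"] by simp
  qed
  finally show ?thesis by (simp add: mean_const S')
qed

text \<open>Provides the bounded range needed for finitely many colours, from the constraint with
  all \<open>f j\<close> set to 0.\<close>

lemma record_stop_prob_le_1:
  assumes "online_algorithm M A" "finite S" "card S = h + Suc i"
  shows "record_stop_prob M A h S \<le> 1"
proof -
  have "real (h + Suc i) * record_stop_prob M A h S \<le> 1"
    using record_stop_prob_constraint[OF assms, of "\<lambda>_. 0"] assms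
    by (simp add: record_stop_prob_nonneg finite_subset)
  moreover have "1 * record_stop_prob M A h S \<le> real (h + Suc i) * record_stop_prob M A h S"
    using assms by (intro mult_right_mono record_stop_prob_nonneg) auto
  ultimately show ?thesis by simp
qed

subsection \<open>The linear program\<close>

text \<open>For \<open>0 \<le> x \<le> 1\<close> this is the maximum of \<open>- y * ln y\<close>
  over \<open>y\<close> between \<open>x\<close> and 1: the limiting chance of winning by accepting
  the first record after a fraction \<open>y\<close> of all candidates, of which a fraction
  \<open>x\<close> is history.\<close>

definition win_bound :: "real \<Rightarrow> real" where
  "win_bound x = (if x \<le> 1 / exp 1 then 1 / exp 1 else - x * ln x)"

text \<open>The inequality \<open>ln t \<le> t - 1\<close> at
  \<open>t = 1 / (exp 1 * x)\<close>.\<close>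

lemma neg_mult_ln_le:
  assumes "0 < x"
  shows "- x * ln x \<le> 1 / exp (1 :: real)"
proof -
  have "ln (1 / (exp 1 * x)) \<le> 1 / (exp 1 * x) - 1"
    using assms by (intro ln_le_minus_one) simp
  then have "- ln x \<le> 1 / (exp 1 * x)"
    using assms by (simp add: ln_div ln_mult)
  then have "x * (- ln x) \<le> x * (1 / (exp 1 * x))"
    using assms by (intro mult_left_mono) auto
  then show ?thesis using assms by simp
qed

lemma neg_mult_ln_le_win_bound: "0 < x \<Longrightarrow> - x * ln x \<le> win_bound x"
  using neg_mult_ln_le by (auto simp: win_bound_def)

lemma mult_ln_diff_le:
  assumes "0 < x" "0 < (y::real)"
  shows "y * (ln x - ln y) \<le> x - y"
proof -
  have "ln (x / y) \<le> x / y - 1"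
    using assms by (intro ln_le_minus_one) simp
  then have "y * (ln x - ln y) \<le> y * (x / y - 1)"
    using assms by (intro mult_left_mono) (auto simp: ln_div)
  also have "\<dots> = x - y"
    using assms by (simp add: field_simps)
  finally show ?thesis .
qed

text \<open>Up to \<open>1 / exp 1\<close> the function is constant at the maximum of
  \<open>- x * ln x\<close>; beyond it, \<open>ln x \<ge> -1\<close> makes the tangent of
  \<open>- x * ln x\<close> nonincreasing.\<close>

lemma win_bound_antimono:
  assumes "0 \<le> x" "x \<le> y"
  shows "win_bound y \<le> win_bound x"
proof (cases "x \<le> 1 / exp 1")
  case True
  have "win_bound y \<le> 1 / exp 1"
  proof (cases "y \<le> 1 / exp 1")
    case False
    then have "0 < y" using less_trans[of 0 "1 / exp (1::real)" y] by simp
    then show ?thesis using False neg_mult_ln_le[of y] by (simp add: win_bound_def)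
  qed (simp add: win_bound_def)
  then show ?thesis using True by (simp add: win_bound_def)
next
  case False
  then have x: "0 < x" using less_trans[of 0 "1 / exp (1::real)" x] by simp
  have "ln (1 / exp 1) \<le> ln x"
    using False x by (subst ln_le_cancel_iff) auto
  then have "0 \<le> (y - x) * (ln x + 1)"
    using assms by (intro mult_nonneg_nonneg) (auto simp: ln_div)
  then have "- y * ln y \<le> - x * ln x"
    using mult_ln_diff_le[of x y] x assms by (simp add: algebra_simps)
  then show ?thesis using False assms by (simp add: win_bound_def)
qed

text \<open>A Bellman inequality: for \<open>x = (K - 1) / N\<close> and \<open>y = K / N\<close>,
  the factor \<open>x / y = 1 - 1 / K\<close> is the chance that the \<open>K\<close>-th candidate
  is no record, and \<open>y - x = 1 / N\<close>.\<close>

lemma win_bound_step: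
  assumes "0 \<le> x" "x < y"
  shows "x / y * (win_bound y + (y - x)) \<le> win_bound x"
proof (cases "x = 0")
  case True
  then show ?thesis by (simp add: win_bound_def)
next
  case False
  then have x: "0 < x" "0 < y" using assms by auto
  show ?thesis
  proof (cases "y \<le> 1 / exp 1")
    case True
    have "x * (y - x) \<le> 1 / exp 1 * (y - x)"
      using True assms by (intro mult_right_mono) auto
    then have "x * (1 / exp 1 + (y - x)) \<le> 1 / exp 1 * y"
      by (simp add: algebra_simps diff_divide_distrib)
    then have "x * (1 / exp 1 + (y - x)) / y \<le> 1 / exp 1"
      using x by (subst pos_divide_le_eq) auto
    then show ?thesis using True assms by (simp add: win_bound_def)
  next
    case False
    have "x / y * (y * (ln x - ln y)) \<le> x / y * (x - y)"
      using x by (intro mult_left_mono mult_ln_diff_le) auto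
    then have "x * (ln x - ln y) \<le> x / y * (x - y)"
      using x by simp
    moreover have "x / y * (- y * ln y + (y - x)) = - (x * ln y) - x / y * (x - y)"
      using x by (simp add: field_simps)
    ultimately have "x / y * (- y * ln y + (y - x)) \<le> - x * ln x"
      by (simp add: right_diff_distrib)
    also have "\<dots> \<le> win_bound x"
      using x by (intro neg_mult_ln_le_win_bound)
    finally show ?thesis using False by (simp add: win_bound_def)
  qed
qed

text \<open>
  \<open>win_bound ((h + k) / N) + 1 / N\<close> bounds from above the winning probability of an optimal
  strategy that has not stopped among the first \<open>k\<close> arrivals, and \<open>1 - (\<Sum>j<k. f j)\<close> is the
  probability of not having stopped at a record before.
\<close>

lemma linear_program_bound:
  fixes f :: "nat \<Rightarrow> real" and n h :: nat
  assumes "1 \<le> n" and N: "N = real (h + n)"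
    and f0: "\<And>i. i < n \<Longrightarrow> 0 \<le> f i"
    and f: "\<And>i. i < n \<Longrightarrow> real (h + Suc i) * f i + (\<Sum>j<i. f j) \<le> 1"
  shows "(\<Sum>i<n. real (h + Suc i) / N * f i) \<le> win_bound (real h / N) + 1 / N"
proof -
  define B where "B k = win_bound (real (h + k) / N) + 1 / N" for k
  have Npos: "0 < N" using assms by simp
  \<comment> \<open>The coefficient \<open>h + Suc i\<close> is at least 1, so each constraint
    bounds the partial sum that includes \<open>f i\<close>.\<close>
  have rem: "0 \<le> 1 - (\<Sum>j<k. f j)" if "k \<le> n" for k
  proof (cases k)
    case (Suc i)
    have "1 * f i \<le> real (h + Suc i) * f i"
      using f0[of i] that Suc by (intro mult_right_mono) auto
    then show ?thesis using f[of i] that Suc by simp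
  qed simp
  \<comment> \<open>The claim is generalised to the tail from \<open>k\<close> on, for induction
    from \<open>n\<close> downwards.\<close>
  have "(\<Sum>i=k..<n. real (h + Suc i) / N * f i) \<le> B k * (1 - (\<Sum>j<k. f j))" if "k \<le> n" for k
    using that
  proof (induction rule: inc_induct)
    case base
    have "B n = 1 / N"
      using Npos N by (simp add: B_def win_bound_def)
    then show ?case using rem[of n] Npos by simp
  next
    case (step k)
    define K where "K = real (h + Suc k)"
    define s where "s = 1 - (\<Sum>j<k. f j)"
    have Kpos: "0 < K" by (simp add: K_def)
    have s: "0 \<le> s" "K * f k \<le> s" "0 \<le> f k"
      using rem[of k] f[of k] f0[of k] step.hyps by (auto simp: s_def K_def)
    have mono: "B (Suc k) \<le> B k"
      unfolding B_def using Npos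
      by (intro add_right_mono win_bound_antimono divide_right_mono) auto
    have "((K - 1) / N) / (K / N) * (win_bound (K / N) + (K / N - (K - 1) / N)) \<le> win_bound ((K - 1) / N)"
      using Npos by (intro win_bound_step) (auto simp: K_def divide_strict_right_mono)
    moreover have "((K - 1) / N) / (K / N) = 1 - 1 / K" "K / N - (K - 1) / N = 1 / N"
      using Npos Kpos by (auto simp: field_simps)
    ultimately have "(1 - 1 / K) * (win_bound (K / N) + 1 / N) \<le> win_bound ((K - 1) / N)"
      by metis
    moreover have "B (Suc k) = win_bound (K / N) + 1 / N" "B k = win_bound ((K - 1) / N) + 1 / N"
      by (simp_all add: B_def K_def)
    ultimately have st: "1 / N + (1 - 1 / K) * B (Suc k) \<le> B k"
      by simp
    have "(\<Sum>i=k..<n. real (h + Suc i) / N * f i)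
        = K / N * f k + (\<Sum>i=Suc k..<n. real (h + Suc i) / N * f i)"
      using step.hyps by (simp add: sum.atLeast_Suc_lessThan K_def)
    also have "\<dots> \<le> K / N * f k + B (Suc k) * (s - f k)"
      using step.IH by (simp add: s_def algebra_simps)
    also have "\<dots> = (K / N - B (Suc k)) * f k + B (Suc k) * s"
      by (simp add: algebra_simps)
    also have "\<dots> \<le> B k * s"
    \<comment> \<open>The sign of the coefficient of \<open>f k\<close> decides: if accepting a
      record pays, \<open>f k\<close> is raised to its limit \<open>s / K\<close>, otherwise its
      term is dropped.\<close>
    proof (cases "B (Suc k) \<le> K / N")
      case True
      then have "(K / N - B (Suc k)) * f k \<le> (K / N - B (Suc k)) * (s / K)"
        using s Kpos by (intro mult_left_mono) (auto simp: field_simps)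
      then have "(K / N - B (Suc k)) * f k + B (Suc k) * s \<le> (1 / N + (1 - 1 / K) * B (Suc k)) * s"
        using Kpos by (simp add: algebra_simps)
      also have "\<dots> \<le> B k * s"
        using st s by (intro mult_right_mono)
      finally show ?thesis .
    next
      case False
      then have "(K / N - B (Suc k)) * f k \<le> 0"
        using s by (intro mult_nonpos_nonneg) auto
      moreover have "B (Suc k) * s \<le> B k * s"
        using mono s by (intro mult_right_mono)
      ultimately show ?thesis by simp
    qed
    finally show ?case by (simp add: s_def)
  qed
  from this[of 0] show ?thesis
    by (simp add: B_def lessThan_atLeast0)
qed

subsection \<open>The upper bound\<close>

text \<open>On the homogeneous set the numbers \<open>f i\<close> are feasible for the linear
  program, and winning at each of the \<open>n\<close> arrivals exceeds its objective term by at
  most \<open>\<epsilon>\<close>.\<close>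

lemma win_prob_le:
  assumes "online_algorithm M A" "1 \<le> n" "\<epsilon> > 0" "infinite (Z :: candidate set)"
  shows "\<exists>Y. Y \<subseteq> Z \<and> infinite Y \<and>
    (\<forall>C. C \<subseteq> Y \<and> finite C \<and> card C = n + h \<longrightarrow>
      (\<Sum>i<n. mean h C (\<lambda>H xs. stop_prob M A H (take (Suc i) xs) * of_bool (xs ! i = Max C)))
        \<le> win_bound (real h / real (n + h)) + 1 / real (n + h) + real n * \<epsilon>)"
proof -
  have "0 \<le> record_stop_prob M A h S \<and> record_stop_prob M A h S \<le> 1"
    if "finite S" "card S = h + Suc i" for S i
    using that assms(1) by (auto intro: record_stop_prob_nonneg record_stop_prob_le_1)
  then obtain Y f where Y: "Y \<subseteq> Z" "infinite Y"
    and f: "\<And>i. i < n \<Longrightarrow> 0 \<le> f i"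
      "\<And>i S. i < n \<Longrightarrow> S \<subseteq> Y \<Longrightarrow> finite S \<Longrightarrow> card S = h + Suc i \<Longrightarrow>
        f i \<le> record_stop_prob M A h S \<and> record_stop_prob M A h S \<le> f i + \<epsilon>"
    using homogeneous_approx[OF assms(4,3), of n "\<lambda>i. h + Suc i" "\<lambda>_. record_stop_prob M A h"]
    by metis
  have constr: "real (h + Suc i) * f i + (\<Sum>j<i. f j) \<le> 1" if "i < n" for i
  proof -
    \<comment> \<open>Any one set of the right size yields the constraint, since \<open>f\<close>
      does not depend on the set.\<close>
    obtain S where S: "S \<subseteq> Y" "finite S" "card S = h + Suc i"
      using infinite_arbitrarily_large[OF Y(2)] by blast
    have "f j \<le> record_stop_prob M A h T" if "j < i" "T \<subseteq> S" "card T = h + Suc j" for j T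
      using that f(2)[of j T] S \<open>i < n\<close> by (auto intro: finite_subset)
    then have "real (h + Suc i) * record_stop_prob M A h S + (\<Sum>j<i. f j) \<le> 1"
      using S assms(1) by (intro record_stop_prob_constraint) auto
    moreover have "real (h + Suc i) * f i \<le> real (h + Suc i) * record_stop_prob M A h S"
      using f(2)[OF that S] by (intro mult_left_mono) auto
    ultimately show ?thesis by linarith
  qed
  have "(\<Sum>i<n. mean h C (\<lambda>H xs. stop_prob M A H (take (Suc i) xs) * of_bool (xs ! i = Max C)))
        \<le> win_bound (real h / real (n + h)) + 1 / real (n + h) + real n * \<epsilon>"
    if C: "C \<subseteq> Y" "finite C" "card C = n + h" for C
  proof -
    have "mean h C (\<lambda>H xs. stop_prob M A H (take (Suc i) xs) * of_bool (xs ! i = Max C))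
        \<le> real (h + Suc i) / real (h + n) * f i + \<epsilon>" if "i < n" for i
    proof -
      have "mean h C (\<lambda>H xs. stop_prob M A H (take (Suc i) xs) * of_bool (xs ! i = Max C))
          \<le> real (h + Suc i) / real (card C) * (f i + \<epsilon>)"
      proof (rule mean_prefix_Max_le)
        fix T assume "T \<subseteq> C" "card T = h + Suc i"
        then show "mean h T (\<lambda>H xs. stop_prob M A H xs * of_bool (last xs = Max T)) \<le> f i + \<epsilon>"
          using f(2)[OF that, of T] C by (auto simp: record_stop_prob_def intro: finite_subset)
      qed (use C that in auto)
      also have "\<dots> = real (h + Suc i) / real (h + n) * f i + real (h + Suc i) / real (h + n) * \<epsilon>"
        using C(3) by (simp only: distrib_left add.commute[of n h])
      also have "\<dots> \<le> real (h + Suc i) / real (h + n) * f i + 1 * \<epsilon>"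
        using that assms(3) by (intro add_left_mono mult_right_mono) auto
      finally show ?thesis by simp
    qed
    then have "(\<Sum>i<n. mean h C (\<lambda>H xs. stop_prob M A H (take (Suc i) xs) * of_bool (xs ! i = Max C)))
        \<le> (\<Sum>i<n. real (h + Suc i) / real (h + n) * f i + \<epsilon>)"
      by (intro sum_mono) auto
    also have "\<dots> = (\<Sum>i<n. real (h + Suc i) / real (h + n) * f i) + real n * \<epsilon>"
      by (simp add: sum.distrib)
    also have "\<dots> \<le> win_bound (real h / real (h + n)) + 1 / real (h + n) + real n * \<epsilon>"
      using f(1) constr assms(2) by (intro add_right_mono linear_program_bound) auto
    finally show ?thesis by (simp add: add.commute)
  qed
  then show ?thesis using Y by blast
qed

text \<open>Stopping anywhere has total probability at most 1 and earns at most \<open>b\<close>,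
  except that \<open>m\<close> earns up to \<open>val m\<close> more.\<close>

lemma expected_alg_le:
  assumes "online_algorithm M A" "finite C" "card C = n + h"
    and b: "0 \<le> b" "\<And>x. x \<in> C \<Longrightarrow> x \<noteq> m \<Longrightarrow> val x \<le> b" and m: "0 \<le> val m"
  shows "expected_alg M A h C \<le>
    b + val m * (\<Sum>i<n. mean h C (\<lambda>H xs. stop_prob M A H (take (Suc i) xs) * of_bool (xs ! i = m)))"
proof -
  let ?p = "\<lambda>H xs i. stop_prob M A H (take (Suc i) xs)"
  have le: "h \<le> card C" using assms by simp
  have "expected_alg M A h C = mean h C (\<lambda>H xs. LINT r|M. alg_value (A r) H xs)"
    by (simp add: expected_alg_def mean_def)
  also have "\<dots> \<le> mean h C (\<lambda>H xs. b + val m * (\<Sum>i<n. ?p H xs i * of_bool (xs ! i = m)))"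
  proof (intro mean_mono assms le)
    fix H xs assume o: "(H, xs) \<in> outcomes h C"
    note D = outcomesD[OF assms(2) o]
    have len: "length xs = n" using D assms by simp
    have "(LINT r|M. alg_value (A r) H xs) = (\<Sum>i<n. val (xs ! i) * ?p H xs i)"
      by (simp add: expected_alg_value[OF assms(1)] len)
    also have "\<dots> \<le> (\<Sum>i<n. (b + val m * of_bool (xs ! i = m)) * ?p H xs i)"
    proof (intro sum_mono mult_right_mono)
      fix i assume "i \<in> {..<n}"
      then have "xs ! i \<in> C" using D len by (metis DiffE lessThan_iff nth_mem)
      then show "val (xs ! i) \<le> b + val m * of_bool (xs ! i = m)"
        using b by (cases "xs ! i = m") auto
    qed (simp add: stop_prob_def)
    also have "\<dots> = b * (\<Sum>i<n. ?p H xs i) + val m * (\<Sum>i<n. ?p H xs i * of_bool (xs ! i = m))"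
      by (simp only: sum_distrib_left sum.distrib[symmetric] distrib_left ac_simps)
    also have "\<dots> \<le> b * 1 + val m * (\<Sum>i<n. ?p H xs i * of_bool (xs ! i = m))"
      using sum_stop_prob_le_1[OF assms(1), of H xs] b len
      by (intro add_right_mono mult_left_mono) auto
    finally show "(LINT r|M. alg_value (A r) H xs)
        \<le> b + val m * (\<Sum>i<n. ?p H xs i * of_bool (xs ! i = m))" by simp
  qed
  also have "\<dots> = b + val m * (\<Sum>i<n. mean h C (\<lambda>H xs. ?p H xs i * of_bool (xs ! i = m)))"
    by (simp only: mean_add mean_cmult mean_sum mean_const assms(2) le)
  finally show ?thesis .
qed

text \<open>The optimum is at least \<open>val m\<close> whenever \<open>m\<close> is online, and
  nonnegative otherwise.\<close>

lemma expected_opt_ge: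
  assumes "finite C" "card C = n + h" "1 \<le> n" "m \<in> C" "\<And>x. x \<in> C \<Longrightarrow> 0 \<le> val x"
  shows "val m * (real n / real (n + h)) \<le> expected_opt h C"
proof -
  have le: "h \<le> card C" using assms by simp
  have "val m * (real n / real (n + h)) = mean h C (\<lambda>H xs. val m * of_bool (m \<in> set xs))"
    using assms by (simp add: mean_cmult mean_online le)
  also have "\<dots> \<le> mean h C (\<lambda>H xs. val (Max (C - H)))"
  proof (intro mean_mono assms le)
    fix H xs assume o: "(H, xs) \<in> outcomes h C"
    note D = outcomesD[OF assms(1) o]
    have fin: "finite (C - H)" using assms by simp
    have "C - H \<noteq> {}" using D assms by auto
    then have "Max (C - H) \<in> C" using Max_in[OF fin] by simp
    moreover have "val m \<le> val (Max (C - H))" if "m \<in> set xs"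
      using Max_ge[OF fin, of m] that D by (auto simp: less_eq_candidate_def)
    ultimately show "val m * of_bool (m \<in> set xs) \<le> val (Max (C - H))"
      using assms by auto
  qed
  also have "\<dots> = expected_opt h C"
    by (simp add: expected_opt_def mean_def)
  finally show ?thesis .
qed

text \<open>The largest value \<open>val m\<close> dwarfs all others, so that only winning with it counts.\<close>

lemma competitive_ratio_le:
  assumes "1 \<le> n" "online_algorithm M A" "competitive n h M A c" "0 \<le> c" "\<epsilon> > 0"
  shows "c * (real n / real (n + h)) \<le>
    win_bound (real h / real (n + h)) + 1 / real (n + h) + real (n + 1) * \<epsilon>"
proof -
  let ?V = "win_bound (real h / real (n + h)) + 1 / real (n + h) + real n * \<epsilon>"
  \<comment> \<open>Distinct integer values allow a constant rank, and every infinite subset has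
    unbounded values.\<close>
  define Z where "Z = range (\<lambda>k. Candidate (real k) 0)"
  have "infinite Z"
    unfolding Z_def by (intro range_inj_infinite) (simp add: inj_def)
  from win_prob_le[OF assms(2,1,5) this, of h]
  obtain Y where Y: "Y \<subseteq> Z" "infinite Y"
    and win: "\<And>C. C \<subseteq> Y \<Longrightarrow> finite C \<Longrightarrow> card C = n + h \<Longrightarrow>
      (\<Sum>i<n. mean h C (\<lambda>H xs. stop_prob M A H (take (Suc i) xs) * of_bool (xs ! i = Max C))) \<le> ?V"
    by blast
  obtain T where T: "T \<subseteq> Y" "finite T" "card T = n + h - 1"
    using infinite_arbitrarily_large[OF Y(2)] by blast
  \<comment> \<open>The element 0 covers the case \<open>T = {}\<close>, which occurs for
    \<open>n = 1\<close> and \<open>h = 0\<close>.\<close>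
  define b where "b = Max (insert 0 (val ` T))"
  have b: "0 \<le> b" "\<And>x. x \<in> T \<Longrightarrow> val x \<le> b"
    using T by (auto simp: b_def)
  \<comment> \<open>A value above \<open>b\<close> makes \<open>m\<close> the maximum; a value above
    \<open>b / \<epsilon>\<close> makes all other values at most
    \<open>\<epsilon> * val m\<close>.\<close>
  define L where "L = b + b / \<epsilon>"
  have L: "b \<le> L" "b / \<epsilon> \<le> L" "0 \<le> L"
    using b assms(5) by (auto simp: L_def)
  have "finite ((\<lambda>k. Candidate (real k) 0) ` {..nat \<lfloor>L\<rfloor>})" by simp
  then obtain m where m: "m \<in> Y" "m \<notin> (\<lambda>k. Candidate (real k) 0) ` {..nat \<lfloor>L\<rfloor>}"
    using Y(2) by (meson finite_subset subsetI)
  then obtain k where k: "m = Candidate (real k) 0" using Y(1) by (auto simp: Z_def)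
  then have "nat \<lfloor>L\<rfloor> < k" using m(2) by (metis atMost_iff imageI not_le)
  then have mL: "L < val m" using L(3) k by (simp add: nat_less_iff floor_less_iff)
  then have mT: "m \<notin> T" using b(2)[of m] L by auto
  define C where "C = insert m T"
  have C: "C \<subseteq> Y" "finite C" "card C = n + h" "m \<in> C"
    using T m mT assms(1) by (auto simp: C_def)
  have "x \<le> m" if "x \<in> C" for x
    using that b(2)[of x] L mL by (auto simp: C_def less_eq_candidate_def)
  then have Max: "Max C = m"
    using C by (intro Max_eqI) auto
  have nonneg: "0 \<le> val x" if "x \<in> C" for x
    using that C(1) Y(1) by (auto simp: Z_def)
  have pos: "0 < val m" using mL L by simp
  have "b \<le> \<epsilon> * L"
    using L(2) assms(5) by (simp add: pos_divide_le_eq mult.commute)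
  also have "\<dots> \<le> \<epsilon> * val m"
    using mL assms(5) by (intro mult_left_mono) auto
  finally have be: "b \<le> \<epsilon> * val m" .
  have "c * (real n / real (n + h)) * val m = c * (val m * (real n / real (n + h)))"
    by simp
  also have "\<dots> \<le> c * expected_opt h C"
    using C nonneg assms by (intro mult_left_mono expected_opt_ge) auto
  also have "\<dots> \<le> expected_alg M A h C"
    using assms(3) C nonneg by (simp add: competitive_def)
  also have "\<dots> \<le> b + val m *
      (\<Sum>i<n. mean h C (\<lambda>H xs. stop_prob M A H (take (Suc i) xs) * of_bool (xs ! i = m)))"
    using assms(2) C b pos by (intro expected_alg_le) (auto simp: C_def)
  also have "\<dots> \<le> \<epsilon> * val m + val m * ?V"
    using win[OF C(1-3)] be pos unfolding Max by (intro add_mono mult_left_mono) auto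
  also have "\<dots> = (?V + \<epsilon>) * val m"
    by (simp add: algebra_simps)
  finally have "c * (real n / real (n + h)) \<le> ?V + \<epsilon>"
    using pos by (simp only: mult_le_cancel_right_pos)
  then show ?thesis by (simp add: algebra_simps)
qed

theorem theorem7:
  fixes n h :: nat and M :: "'r measure" and A :: "'r \<Rightarrow> decision_rule" and c :: real
  assumes "n \<ge> 1"
    and "online_algorithm M A"
    and "competitive n h M A c"
  shows "c \<le> (if real h / real (n + h) \<le> 1 / exp 1
               then 1 / exp 1 * (real (n + h) / real n) + 1 / real n
               else real h / real n * ln (real (h + n) / real h) + 1 / real n)"
    (is "_ \<le> ?bound")
proof -
  let ?N = "real (n + h)"
  let ?B = "win_bound (real h / ?N) + 1 / ?N"
  have pos: "0 < real n" "0 < ?N" using assms(1) by auto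
  have "?B * (?N / real n) = win_bound (real h / ?N) * (?N / real n) + 1 / real n"
    using pos by (simp add: distrib_right add_divide_distrib del: of_nat_add)
  also have "\<dots> = ?bound"
  proof (cases "real h / ?N \<le> 1 / exp 1")
    case True
    then show ?thesis by (simp add: win_bound_def)
  next
    case False
    \<comment> \<open>For \<open>h = 0\<close> the ratio is 0 and the first case of the bound
      applies.\<close>
    then have "h > 0" by (cases h) auto
    then have "ln (real h / ?N) = - ln (?N / real h)"
      using pos by (simp add: ln_div)
    then have "win_bound (real h / ?N) = real h / ?N * ln (?N / real h)"
      using False by (simp add: win_bound_def del: of_nat_add)
    then show ?thesis using False pos by (simp add: add.commute)
  qed
  finally have bound: "?B * (?N / real n) = ?bound" .
  show ?thesis
  proof (cases "0 \<le> c")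
    case True
    have "c * (real n / ?N) \<le> ?B"
    proof (rule field_le_epsilon)
      fix e :: real assume "0 < e"
      \<comment> \<open>There are \<open>n\<close> losses of \<open>\<epsilon>\<close> from
        homogeneity and one from the small values, hence the division by
        \<open>n + 1\<close>.\<close>
      then show "c * (real n / ?N) \<le> ?B + e"
        using competitive_ratio_le[OF assms True, of "e / real (n + 1)"] by simp
    qed
    then have "c * (real n / ?N) * (?N / real n) \<le> ?B * (?N / real n)"
      using pos by (intro mult_right_mono) auto
    moreover have "c * (real n / ?N) * (?N / real n) = c"
      using pos by (simp del: of_nat_add)
    ultimately show ?thesis using bound by simp
  next
    case False
    \<comment> \<open>A negative \<open>c\<close> only needs a nonnegative bound, which follows by
      monotonicity from \<open>win_bound 1 = 0\<close>.\<close>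
    have "win_bound 1 \<le> win_bound (real h / ?N)"
      using pos by (intro win_bound_antimono) auto
    then have "0 \<le> ?B * (?N / real n)"
      using pos by (intro mult_nonneg_nonneg add_nonneg_nonneg) (auto simp: win_bound_def)
    then show ?thesis using False bound by simp
  qed
qed

end
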